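(* Let $u=(u_i)_{i\in\mathbb Z}$ be a real sequence with only finitely many nonzero terms, let $v_{\sup}=\sup_i(u_i+u_{i+1})$, and let $k=\min(v_{\sup},1)$. Let $(l,\ldots,l+s)$ be a soliton of $u$, let $\Phi^{(1)}$ and $\Phi^{(2)}$ be the pair of fundamental eigenvectors of $A(\gamma)$, respectively $A(\delta)$, associated with it, and let $$\tilde u_i:=u_i+\Phi^{(1)}_{i+1}+\Phi^{(2)}_i-\Phi^{(1)}_i-\Phi^{(2)}_{i+1},\qquad i\in\mathbb Z .$$ Then in the case (C1) $$\tilde u_i=\begin{cases}u_{i-1}, & i\le l,\\ u_{i-1}=u_{i+1}, & l<i<l+s,\\ u_{i+1}, & i\ge l+s,\end{cases}$$ (in the middle line, $u_{i-1}=u_{i+1}$ is part of the assertion), and in the case (C2) $$\tilde u_i=\begin{cases}u_{i-1}, & i\le l,\\ 1-u_i, & l<i<l+s,\\ u_{i+1}, & i\ge l+s.\end{cases}$$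
   Context: Max-plus conventions: on $\mathbb R\cup\{-\infty\}$, $a\oplus b=\max(a,b)$, $a\otimes b=a+b$, extended to matrices and vectors in the usual way. Put $\gamma_i=\min(u_i,1-u_{i-1})$ and $\delta_i=\min(u_{i-1},1-u_i)$. The $\mathbb Z\times\mathbb Z$ matrix $A(\gamma)$ has entries $A(\gamma)_{i,i+1}=\gamma_i-k$, $A(\gamma)_{i,i-1}=\gamma_i$, and all other entries $-\infty$; $A(\delta)$ is defined in the same way with $\delta_i$ in place of $\gamma_i$. Case (C1) means $v_{\sup}\le 1$; case (C2) means $v_{\sup}\ge 1$ (the borderline $v_{\sup}=1$ may be regarded in both ways). Soliton (with $s\ge 1$): in case (C1), a sequence of indices $(l,l+1,\ldots,l+s)$ such that $u_l+u_{l+1}=\cdots=u_{l+s-1}+u_{l+s}=v_{\sup}$ while $u_{l-1}+u_l<v_{\sup}$ and $u_{l+s}+u_{l+s+1}<v_{\sup}$; in case (C2), a sequence of indices $(l,\ldots,l+s)$ such that $u_l+u_{l+1}\ge 1,\ldots,u_{l+s-1}+u_{l+s}\ge 1$ while $u_{l-1}+u_l<1$ and $u_{l+s}+u_{l+s+1}<1$. For $A$ equal to $A(\gamma)$ or $A(\delta)$, the Kleene star is $A^*=I\oplus A\oplus A^2\oplus\cdots$ ($I$ has $0$ on the diagonal and $-\infty$ elsewhere); $A^*_{ij}$, $i\neq j$, is the greatest weight (sum of entries) of a path from $i$ to $j$ in the digraph on $\mathbb Z$ with edges $(i,j)$, $A_{ij}\ne-\infty$. The critical graph of $A$ consists of the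 nodes and edges of the two-cycles of greatest total weight (which is $0$ for $k=\min(v_{\sup},1)$, where $v_{\sup}=\sup_i(u_i+u_{i+1})$). The pair of fundamental eigenvectors associated with the soliton $(l,\ldots,l+s)$ consists of columns of the Kleene stars indexed by critical nodes of the corresponding strongly connected components of the critical graphs: $\Phi^{(1)}$ is column $l$ (equivalently, up to an additive constant, column $l+1$) of $A(\gamma)^*$, and $\Phi^{(2)}$ is column $l+s$ (equivalently, up to an additive constant, column $l+s+1$) of $A(\delta)^*$; each is defined up to an additive constant. *)

theory Defs
  imports "HOL-Library.Extended_Real"
begin

text \<open>
  The max-plus semiring is rendered inside \<^typ>\<open>ereal\<close>: \<open>a \<oplus> b\<close> is \<open>sup a b\<close> and \<open>a \<otimes> b\<close> is \<open>a + b\<close>.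
  Infinite max-plus sums are suprema. The value \<open>\<infinity>\<close> is not an entry of any matrix below, and
  \<open>-\<infinity> + x = -\<infinity>\<close> for \<open>x \<noteq> \<infinity>\<close>, so \<open>-\<infinity>\<close> behaves as the max-plus zero.
\<close>

type_synonym mp_matrix = "int \<Rightarrow> int \<Rightarrow> ereal"

definition mp_one :: mp_matrix where
  "mp_one i j = (if i = j then 0 else -\<infinity>)"

definition mp_mult :: "mp_matrix \<Rightarrow> mp_matrix \<Rightarrow> mp_matrix" where
  "mp_mult A B i j = (SUP m. A i m + B m j)"

primrec mp_power :: "mp_matrix \<Rightarrow> nat \<Rightarrow> mp_matrix" where
  "mp_power A 0 = mp_one"
| "mp_power A (Suc n) = mp_mult A (mp_power A n)"

definition kleene_star :: "mp_matrix \<Rightarrow> mp_matrix" where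
  "kleene_star A i j = (SUP n. mp_power A n i j)"

definition two_cycle :: "mp_matrix \<Rightarrow> int \<Rightarrow> int \<Rightarrow> bool" where
  "two_cycle A i j \<longleftrightarrow> i \<noteq> j \<and> A i j \<noteq> -\<infinity> \<and> A j i \<noteq> -\<infinity>"

definition critical_edges :: "mp_matrix \<Rightarrow> (int \<times> int) set" where
  "critical_edges A = {(i, j). two_cycle A i j \<and>
     (\<forall>p q. two_cycle A p q \<longrightarrow> A p q + A q p \<le> A i j + A j i)}"

definition critical_component :: "mp_matrix \<Rightarrow> int \<Rightarrow> int set" where
  "critical_component A i =
     {j. (i, j) \<in> (critical_edges A)\<^sup>* \<and> (j, i) \<in> (critical_edges A)\<^sup>*}"

text \<open>
  Fundamental eigenvectors are defined up to an additive constant, and any node of the strongly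
  connected component of \<open>i\<close> in the critical graph (\<open>i\<close> itself included) may index the column.
\<close>

definition fundamental_eigenvector :: "mp_matrix \<Rightarrow> int \<Rightarrow> (int \<Rightarrow> real) \<Rightarrow> bool" where
  "fundamental_eigenvector A i \<Phi> \<longleftrightarrow>
     (\<exists>j \<in> critical_component A i. \<exists>c::real.
        \<forall>m. ereal (\<Phi> m) = kleene_star A m j + ereal c)"

definition v_sup :: "(int \<Rightarrow> real) \<Rightarrow> real" where
  "v_sup u = (SUP i. u i + u (i + 1))"

definition kval :: "(int \<Rightarrow> real) \<Rightarrow> real" where
  "kval u = min (v_sup u) 1"

definition gam :: "(int \<Rightarrow> real) \<Rightarrow> int \<Rightarrow> real" where
  "gam u i = min (u i) (1 - u (i - 1))"

definition del :: "(int \<Rightarrow> real) \<Rightarrow> int \<Rightarrow> real" where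
  "del u i = min (u (i - 1)) (1 - u i)"

definition Amat :: "real \<Rightarrow> (int \<Rightarrow> real) \<Rightarrow> mp_matrix" where
  "Amat k g i j =
     (if j = i + 1 then ereal (g i - k) else if j = i - 1 then ereal (g i) else -\<infinity>)"

text \<open>At the borderline \<open>v_sup u = 1\<close> both cases apply.\<close>

definition case_C1 :: "(int \<Rightarrow> real) \<Rightarrow> bool" where
  "case_C1 u \<longleftrightarrow> v_sup u \<le> 1"

definition case_C2 :: "(int \<Rightarrow> real) \<Rightarrow> bool" where
  "case_C2 u \<longleftrightarrow> v_sup u \<ge> 1"

definition soliton_C1 :: "(int \<Rightarrow> real) \<Rightarrow> int \<Rightarrow> int \<Rightarrow> bool" where
  "soliton_C1 u l s \<longleftrightarrow> s \<ge> 1 \<and>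
     (\<forall>i \<in> {l..<l + s}. u i + u (i + 1) = v_sup u) \<and>
     u (l - 1) + u l < v_sup u \<and> u (l + s) + u (l + s + 1) < v_sup u"

definition soliton_C2 :: "(int \<Rightarrow> real) \<Rightarrow> int \<Rightarrow> int \<Rightarrow> bool" where
  "soliton_C2 u l s \<longleftrightarrow> s \<ge> 1 \<and>
     (\<forall>i \<in> {l..<l + s}. u i + u (i + 1) \<ge> 1) \<and>
     u (l - 1) + u l < 1 \<and> u (l + s) + u (l + s + 1) < 1"

text \<open>\<open>soliton u l s\<close> says that \<open>(l, l + 1, \<dots>, l + s)\<close> is a soliton of \<open>u\<close>.\<close>

definition soliton :: "(int \<Rightarrow> real) \<Rightarrow> int \<Rightarrow> int \<Rightarrow> bool" where
  "soliton u l s \<longleftrightarrow> (case_C1 u \<and> soliton_C1 u l s) \<or> (case_C2 u \<and> soliton_C2 u l s)"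

definition fundamental_pair ::
  "(int \<Rightarrow> real) \<Rightarrow> int \<Rightarrow> int \<Rightarrow> (int \<Rightarrow> real) \<Rightarrow> (int \<Rightarrow> real) \<Rightarrow> bool" where
  "fundamental_pair u l s \<Phi>1 \<Phi>2 \<longleftrightarrow>
     fundamental_eigenvector (Amat (kval u) (gam u)) l \<Phi>1 \<and>
     fundamental_eigenvector (Amat (kval u) (del u)) (l + s) \<Phi>2"

definition utilde ::
  "(int \<Rightarrow> real) \<Rightarrow> (int \<Rightarrow> real) \<Rightarrow> (int \<Rightarrow> real) \<Rightarrow> int \<Rightarrow> real" where
  "utilde u \<Phi>1 \<Phi>2 i = u i + \<Phi>1 (i + 1) + \<Phi>2 i - \<Phi>1 i - \<Phi>2 (i + 1)"

end

theory Submission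
  imports Defs
begin

text \<open>
  For \<open>k = min (v_sup u) 1\<close> all two-cycles of \<open>A(\<gamma>)\<close> and \<open>A(\<delta>)\<close> have nonpositive weight, and every
  cycle of a tridiagonal digraph decomposes into two-cycles. Hence the heaviest path is the direct one,
  and the increments of a column of the Kleene star are entries of the matrix up to sign. The
  theorem follows from \<open>min a (1 - b) - a = min b (1 - a) - b\<close> and from the values of \<open>\<gamma>\<close> and \<open>\<delta>\<close>
  on the soliton.
\<close>

text \<open>An edge \<open>(i, i + 1)\<close> carries \<open>g i - k\<close> and an edge
  \<open>(i, i - 1)\<close> carries \<open>g i\<close>. At least one of the two intervals is empty,
  so this is the weight of the monotone path from \<open>m\<close> to \<open>j\<close>.\<close>

definition direct_weight :: "real \<Rightarrow> (int \<Rightarrow> real) \<Rightarrow> int \<Rightarrow> int \<Rightarrow> real" where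
  "direct_weight k g j m = (\<Sum>i\<in>{m..<j}. g i - k) + (\<Sum>i\<in>{j<..m}. g i)"

definition column_increment :: "real \<Rightarrow> (int \<Rightarrow> real) \<Rightarrow> int \<Rightarrow> int \<Rightarrow> real" where
  "column_increment k g j m = (if m < j then k - g m else g (m + 1))"

lemma direct_weight_self: "direct_weight k g j j = 0"
  by (simp add: direct_weight_def)

lemma direct_weight_step:
  "direct_weight k g j (m + 1) = direct_weight k g j m + column_increment k g j m"
proof (cases "m < j")
  case True
  then have "{m..<j} = insert m {m + 1..<j}" "{j<..m} = {}" "{j<..m + 1} = {}"
    by auto
  then show ?thesis
    using True by (simp add: direct_weight_def column_increment_def)
next
  case False
  then have "{j<..m + 1} = insert (m + 1) {j<..m}" "{m..<j} = {}" "{m + 1..<j} = {}"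
    by auto
  then show ?thesis
    using False by (simp add: direct_weight_def column_increment_def)
qed

lemma Amat_simps:
  "Amat k g i (i + 1) = ereal (g i - k)" "Amat k g (i + 1) i = ereal (g (i + 1))"
  by (simp_all add: Amat_def)

text \<open>The direct weights towards \<open>j\<close> form a potential: a step towards
  \<open>j\<close> gives equality, a step away adds the nonpositive weight of a two-cycle. Iterating
  this bounds every path.\<close>

lemma Amat_step_le_direct_weight:
  assumes "\<And>i. g i + g (i + 1) \<le> k"
  shows "Amat k g m m' + ereal (direct_weight k g j m') \<le> ereal (direct_weight k g j m)"
proof -
  consider "m' = m + 1" | "m = m' + 1" | "m' \<noteq> m + 1" "m \<noteq> m' + 1"
    by blast
  then show ?thesis
  proof cases
    case 1
    then show ?thesis
      using assms[of m] by (simp add: Amat_simps direct_weight_step column_increment_def)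
  next
    case 2
    then show ?thesis
      using assms[of m'] by (simp add: Amat_simps direct_weight_step column_increment_def)
  next
    case 3
    then show ?thesis
      by (simp add: Amat_def)
  qed
qed

lemma mp_power_le_direct_weight:
  assumes "\<And>i. g i + g (i + 1) \<le> k"
  shows "mp_power (Amat k g) n m j \<le> ereal (direct_weight k g j m)"
proof (induction n arbitrary: m)
  case 0
  show ?case
    by (simp add: mp_one_def direct_weight_self)
next
  case (Suc n)
  have "Amat k g m m' + mp_power (Amat k g) n m' j \<le> ereal (direct_weight k g j m)" for m'
    using order_trans[OF add_left_mono[OF Suc.IH] Amat_step_le_direct_weight[of g k, OF assms]] .
  then show ?case
    by (simp add: mp_mult_def SUP_least)
qed

lemma mp_power_Suc_ge: "A m m' + mp_power A n m' j \<le> mp_power A (Suc n) m j"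
  unfolding mp_power.simps mp_mult_def by (rule SUP_upper) simp

text \<open>The monotone path has exactly \<open>n\<close> edges; the induction prepends the edge
  farthest from \<open>j\<close>.\<close>

lemma direct_weight_le_mp_power_below:
  "ereal (direct_weight k g j (j - int n)) \<le> mp_power (Amat k g) n (j - int n) j"
proof (induction n)
  case 0
  show ?case
    by (simp add: mp_one_def direct_weight_self)
next
  case (Suc n)
  let ?m = "j - int (Suc n)"
  have m: "j - int n = ?m + 1"
    by simp
  have "ereal (direct_weight k g j ?m) = Amat k g ?m (?m + 1) + ereal (direct_weight k g j (?m + 1))"
    by (simp only: direct_weight_step Amat_simps) (simp add: column_increment_def)
  also have "\<dots> \<le> Amat k g ?m (?m + 1) + mp_power (Amat k g) n (?m + 1) j"
    using Suc.IH unfolding m by (rule add_left_mono)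
  also have "\<dots> \<le> mp_power (Amat k g) (Suc n) ?m j"
    by (rule mp_power_Suc_ge)
  finally show ?case .
qed

lemma direct_weight_le_mp_power_above:
  "ereal (direct_weight k g j (j + int n)) \<le> mp_power (Amat k g) n (j + int n) j"
proof (induction n)
  case 0
  show ?case
    by (simp add: mp_one_def direct_weight_self)
next
  case (Suc n)
  let ?m = "j + int n"
  have m: "j + int (Suc n) = ?m + 1"
    by simp
  have "ereal (direct_weight k g j (?m + 1)) = Amat k g (?m + 1) ?m + ereal (direct_weight k g j ?m)"
    by (simp only: direct_weight_step Amat_simps) (simp add: column_increment_def)
  also have "\<dots> \<le> Amat k g (?m + 1) ?m + mp_power (Amat k g) n ?m j"
    using Suc.IH by (rule add_left_mono)
  also have "\<dots> \<le> mp_power (Amat k g) (Suc n) (?m + 1) j"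
    by (rule mp_power_Suc_ge)
  finally show ?case
    unfolding m .
qed

lemma kleene_star_Amat:
  assumes "\<And>i. g i + g (i + 1) \<le> k"
  shows "kleene_star (Amat k g) m j = ereal (direct_weight k g j m)"
proof (rule antisym)
  show "kleene_star (Amat k g) m j \<le> ereal (direct_weight k g j m)"
    unfolding kleene_star_def by (intro SUP_least mp_power_le_direct_weight assms)
  \<comment> \<open>The supremum is attained at the exponent equal to the distance between
    \<open>m\<close> and \<open>j\<close>.\<close>
  have "\<exists>n. ereal (direct_weight k g j m) \<le> mp_power (Amat k g) n m j"
  proof (cases "m \<le> j")
    case True
    then show ?thesis
      using direct_weight_le_mp_power_below[of k g j "nat (j - m)"] by auto
  next
    case False
    then show ?thesis
      using direct_weight_le_mp_power_above[of k g j "nat (m - j)"] by auto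
  qed
  then show "ereal (direct_weight k g j m) \<le> kleene_star (Amat k g) m j"
    unfolding kleene_star_def by (auto intro: SUP_upper2)
qed

lemma two_cycle_Amat: "two_cycle (Amat k g) p q \<longleftrightarrow> q = p + 1 \<or> p = q + 1"
  by (auto simp: two_cycle_def Amat_def)

text \<open>The two-cycle on \<open>i\<close> and \<open>i + 1\<close> has weight 0, so a two-cycle
  of greatest weight cannot weigh less.\<close>

lemma critical_edge_Amat:
  assumes "g i + g (i + 1) = k" and "(p, q) \<in> critical_edges (Amat k g)"
  shows "(q = p + 1 \<and> g p + g q \<ge> k) \<or> (p = q + 1 \<and> g p + g q \<ge> k)"
proof -
  have "two_cycle (Amat k g) p q"
    and "Amat k g i (i + 1) + Amat k g (i + 1) i \<le> Amat k g p q + Amat k g q p"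
    using assms(2) by (auto simp: critical_edges_def two_cycle_Amat)
  then show ?thesis
    using assms(1) by (auto simp: two_cycle_Amat Amat_simps)
qed

text \<open>Passing from \<open>j\<close> to \<open>j + 1\<close> affects only the increment at
  \<open>j\<close>, which turns from \<open>g (j + 1)\<close> into \<open>k - g j\<close>.\<close>

lemma column_increment_adjacent:
  assumes "g j + g (j + 1) = k"
  shows "column_increment k g (j + 1) = column_increment k g j"
  using assms by (auto simp: fun_eq_iff column_increment_def)

text \<open>Along a path of critical edges, \<open>le\<close> sharpens each bound to equality, so no
  edge changes the increments. Hence the choice of column within the component does not
  matter.\<close>

lemma column_increment_critical_component:
  assumes le: "\<And>i. g i + g (i + 1) \<le> k" and crit: "g i + g (i + 1) = k"
    and "j \<in> critical_component (Amat k g) i"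
  shows "column_increment k g j = column_increment k g i"
proof -
  have "(i, j) \<in> (critical_edges (Amat k g))\<^sup>*"
    using assms(3) by (simp add: critical_component_def)
  then show ?thesis
  proof (induction rule: rtrancl_induct)
    case (step p q)
    from critical_edge_Amat[OF crit step.hyps(2)]
    have "column_increment k g q = column_increment k g p"
    proof
      assume "q = p + 1 \<and> g p + g q \<ge> k"
      then have "g p + g (p + 1) = k"
        using le[of p] by auto
      then show ?thesis
        using \<open>q = p + 1 \<and> _\<close> by (simp add: column_increment_adjacent)
    next
      assume "p = q + 1 \<and> g p + g q \<ge> k"
      then have "g q + g (q + 1) = k"
        using le[of q] by auto
      then show ?thesis
        using \<open>p = q + 1 \<and> _\<close> by (simp add: column_increment_adjacent)
    qed
    then show ?case
      using step.IH by simp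
  qed simp
qed

text \<open>Taking differences cancels the additive constant.\<close>

lemma fundamental_eigenvector_increment:
  assumes le: "\<And>i. g i + g (i + 1) \<le> k" and crit: "g i + g (i + 1) = k"
    and "fundamental_eigenvector (Amat k g) i \<Phi>"
  shows "\<Phi> (m + 1) - \<Phi> m = column_increment k g i m"
proof -
  obtain j c where j: "j \<in> critical_component (Amat k g) i"
    and "\<And>m. ereal (\<Phi> m) = kleene_star (Amat k g) m j + ereal c"
    using assms(3) by (auto simp: fundamental_eigenvector_def)
  then have "\<Phi> m = direct_weight k g j m + c" for m
    by (simp add: kleene_star_Amat[of g k, OF le])
  then have "\<Phi> (m + 1) - \<Phi> m = column_increment k g j m"
    by (simp add: direct_weight_step)
  then show ?thesis
    by (simp add: column_increment_critical_component[of g k, OF le crit j])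
qed

text \<open>A real \<open>SUP\<close> is known to be an upper bound only for a bounded family;
  finite support supplies the bound.\<close>

lemma adjacent_sum_le_v_sup:
  assumes "finite {i. u i \<noteq> 0}"
  shows "u i + u (i + 1) \<le> v_sup u"
proof -
  have "finite (u ` {i. u i \<noteq> 0})"
    using assms by simp
  moreover have "range u \<subseteq> insert 0 (u ` {i. u i \<noteq> 0})"
    by auto
  ultimately have "bdd_above (range u)"
    by (meson bdd_above_finite finite_insert finite_subset)
  then obtain M where "\<And>i. u i \<le> M"
    by (auto simp: bdd_above_def)
  then have "u i + u (i + 1) \<le> M + M" for i
    by (intro add_mono)
  then have "bdd_above (range (\<lambda>i. u i + u (i + 1)))"
    by (intro bdd_aboveI[of _ "M + M"]) auto
  then show ?thesis
    unfolding v_sup_def by (rule cSUP_upper[OF UNIV_I])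
qed

text \<open>Both \<open>gam u i - u i\<close> and \<open>del u i - u (i - 1)\<close> equal
  \<open>min 0 (1 - u i - u (i - 1))\<close>.\<close>

lemma gam_del: "u i - gam u i + del u i = u (i - 1)"
  by (auto simp: gam_def del_def)

theorem theorem2p11:
  fixes u \<Phi>1 \<Phi>2 :: "int \<Rightarrow> real" and l s :: int
  assumes "finite {i. u i \<noteq> 0}"
    and "soliton u l s"
    and "fundamental_pair u l s \<Phi>1 \<Phi>2"
  shows "(case_C1 u \<longrightarrow> (\<forall>i.
            (i \<le> l \<longrightarrow> utilde u \<Phi>1 \<Phi>2 i = u (i - 1)) \<and>
            (l < i \<and> i < l + s \<longrightarrow> utilde u \<Phi>1 \<Phi>2 i = u (i - 1) \<and> u (i - 1) = u (i + 1)) \<and>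
            (i \<ge> l + s \<longrightarrow> utilde u \<Phi>1 \<Phi>2 i = u (i + 1)))) \<and>
         (case_C2 u \<longrightarrow> (\<forall>i.
            (i \<le> l \<longrightarrow> utilde u \<Phi>1 \<Phi>2 i = u (i - 1)) \<and>
            (l < i \<and> i < l + s \<longrightarrow> utilde u \<Phi>1 \<Phi>2 i = 1 - u i) \<and>
            (i \<ge> l + s \<longrightarrow> utilde u \<Phi>1 \<Phi>2 i = u (i + 1))))"
proof -
  have sup: "u i + u (i + 1) \<le> v_sup u" for i
    by (rule adjacent_sum_le_v_sup[OF assms(1)])
  have sup': "u (i - 1) + u i \<le> v_sup u" for i
    using sup[of "i - 1"] by simp
  have s: "s \<ge> 1"
    using assms(2) by (auto simp: soliton_def soliton_C1_def soliton_C2_def)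
  \<comment> \<open>Phrasing this with \<open>kval\<close> makes it uniform: at the borderline, a
    soliton of either kind serves both conclusions.\<close>
  have inner: "u i + u (i + 1) \<ge> kval u" if "l \<le> i" "i < l + s" for i
    using assms(2) that
    by (auto simp: soliton_def soliton_C1_def soliton_C2_def kval_def case_C1_def case_C2_def)
  have ends: "u (l - 1) + u l < kval u" "u (l + s) + u (l + s + 1) < kval u"
    using assms(2)
    by (auto simp: soliton_def soliton_C1_def soliton_C2_def kval_def case_C1_def case_C2_def)
  have k: "kval u = v_sup u \<and> v_sup u \<le> 1 \<or> kval u = 1 \<and> v_sup u \<ge> 1"
    by (auto simp: kval_def)
  \<comment> \<open>The sum is at most \<open>u i + u (i + 1)\<close>, and also at most
    \<open>u i + (1 - u i) = 1\<close>.\<close>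
  have gam_le: "gam u i + gam u (i + 1) \<le> kval u" for i
    using k sup[of i] by (auto simp: gam_def)
  have del_le: "del u i + del u (i + 1) \<le> kval u" for i
    using k sup'[of i] by (auto simp: del_def)
  \<comment> \<open>The left end condition gives \<open>gam u l = u l\<close>, and the first soliton
    sum gives \<open>gam u (l + 1) = kval u - u l\<close>.\<close>
  have gam_crit: "gam u l + gam u (l + 1) = kval u"
    using k sup[of l] inner[of l] ends s by (auto simp: gam_def)
  \<comment> \<open>Mirror image: \<open>del u (l + s + 1) = u (l + s)\<close> and
    \<open>del u (l + s) = kval u - u (l + s)\<close>.\<close>
  have del_crit: "del u (l + s) + del u (l + s + 1) = kval u"
    using k sup'[of "l + s"] inner[of "l + s - 1"] ends s by (auto simp: del_def)
  have \<Phi>1: "\<Phi>1 (i + 1) - \<Phi>1 i = column_increment (kval u) (gam u) l i" for i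
    using assms(3)
    by (intro fundamental_eigenvector_increment gam_le gam_crit) (simp add: fundamental_pair_def)
  have \<Phi>2: "\<Phi>2 (i + 1) - \<Phi>2 i = column_increment (kval u) (del u) (l + s) i" for i
    using assms(3)
    by (intro fundamental_eigenvector_increment del_le del_crit) (simp add: fundamental_pair_def)
  have utilde: "utilde u \<Phi>1 \<Phi>2 i =
      u i + column_increment (kval u) (gam u) l i - column_increment (kval u) (del u) (l + s) i" for i
    using \<Phi>1[of i] \<Phi>2[of i] by (simp add: utilde_def)
  have left: "utilde u \<Phi>1 \<Phi>2 i = u (i - 1)" if "i \<le> l" for i
  proof -
    \<comment> \<open>At \<open>i = l\<close> the increment is \<open>gam u (l + 1)\<close>;
      criticality rewrites it into the form valid for \<open>i < l\<close>.\<close>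
    have "column_increment (kval u) (gam u) l i = kval u - gam u i"
      using that gam_crit by (cases "i = l") (auto simp: column_increment_def)
    then show ?thesis
      using that s gam_del[of u i] by (simp add: utilde column_increment_def)
  qed
  have right: "utilde u \<Phi>1 \<Phi>2 i = u (i + 1)" if "i \<ge> l + s" for i
    using that s gam_del[of u "i + 1"] by (simp add: utilde column_increment_def)
  \<comment> \<open>Here \<open>i\<close> lies above \<open>l\<close> but below
    \<open>l + s\<close>, so the two increments come from opposite branches.\<close>
  have mid: "utilde u \<Phi>1 \<Phi>2 i = u i + gam u (i + 1) - kval u + del u i"
    if "l < i" "i < l + s" for i
    using that by (simp add: utilde column_increment_def)
  \<comment> \<open>Both sums around \<open>i\<close> equal \<open>kval u\<close>, at most 1, so
    \<open>gam u (i + 1) = u (i + 1)\<close> and \<open>del u i = u (i - 1)\<close>.\<close>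
  have mid_C1: "utilde u \<Phi>1 \<Phi>2 i = u (i - 1) \<and> u (i - 1) = u (i + 1)"
    if "case_C1 u" "l < i" "i < l + s" for i
    using that k sup[of i] sup'[of i] inner[of i] inner[of "i - 1"]
    by (auto simp: mid gam_def del_def case_C1_def)
  \<comment> \<open>Both sums around \<open>i\<close> are at least 1, so
    \<open>gam u (i + 1)\<close> and \<open>del u i\<close> are both \<open>1 - u i\<close>.\<close>
  have mid_C2: "utilde u \<Phi>1 \<Phi>2 i = 1 - u i" if "case_C2 u" "l < i" "i < l + s" for i
    using that k inner[of i] inner[of "i - 1"]
    by (auto simp: mid gam_def del_def case_C2_def)
  show ?thesis
    using left right mid_C1 mid_C2 by blast
qed

end
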